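(* Let $X$ be a metric space without isolated points and let $G$ be an open subset of $X$. Then there exists a continuous function $f\colon X\to\mathbb{R}$ such that $L^\infty(f)=G$ and $\mathbb{L}^\infty(f)=\overline{G}$.
   Context: The metric on $X$ is denoted $|\cdot-\cdot|_X$ and $B(x,r)=\{u\in X:|u-x|_X<r\}$; $\overline{G}$ is the closure of $G$ in $X$. For $f\colon X\to\mathbb{R}$ and $x\in X$, with values in $[0,+\infty]$: - $\operatorname{\mathbb{L}ip} f(x)=\limsup_{(u,v)\to(x,x),\,u\ne v}\frac{|f(u)-f(v)|}{|u-v|_X}=\inf_{r>0}\sup_{u\neq v\in B(x,r)}\frac{|f(u)-f(v)|}{|u-v|_X}$ (local Lipschitz derivative); - $\operatorname{Lip} f(x)=\limsup_{u\to x,\,u\ne x}\frac{|f(u)-f(x)|}{|u-x|_X}$ (big Lipschitz derivative). $\mathbb{L}^\infty(f)=\{x:\operatorname{\mathbb{L}ip} f(x)=\infty\}$ and $L^\infty(f)=\{x:\operatorname{Lip} f(x)=\infty\}$. *)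

theory Defs
  imports "HOL-Analysis.Analysis"
begin

definition big_Lip :: "('a::metric_space \<Rightarrow> real) \<Rightarrow> 'a \<Rightarrow> ennreal" where
  "big_Lip f x = Limsup (at x) (\<lambda>u. ennreal (\<bar>f u - f x\<bar> / dist u x))"

definition local_Lip :: "('a::metric_space \<Rightarrow> real) \<Rightarrow> 'a \<Rightarrow> ennreal" where
  "local_Lip f x =
     Limsup (at (x, x) within {(u, v). u \<noteq> v}) (\<lambda>(u, v). ennreal (\<bar>f u - f v\<bar> / dist u v))"

definition big_Lip_infty :: "('a::metric_space \<Rightarrow> real) \<Rightarrow> 'a set" where
  "big_Lip_infty f = {x. big_Lip f x = \<infinity>}"

definition local_Lip_infty :: "('a::metric_space \<Rightarrow> real) \<Rightarrow> 'a set" where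
  "local_Lip_infty f = {x. local_Lip f x = \<infinity>}"

lemma local_Lip_eq_INF_SUP:
  "local_Lip f x =
     (INF r\<in>{0<..}. SUP (u, v)\<in>{(u, v). u \<in> ball x r \<and> v \<in> ball x r \<and> u \<noteq> v}.
        ennreal (\<bar>f u - f v\<bar> / dist u v))" (is "_ = (INF r\<in>_. Sup (?q ` ?S r))")
proof (rule antisym)
  let ?F = "at (x, x) within {(u, v). u \<noteq> v}"
  show "local_Lip f x \<le> (INF r\<in>{0<..}. Sup (?q ` ?S r))"
  proof (rule INF_greatest)
    fix r :: real assume "r \<in> {0<..}"
    then have "open (ball x r \<times> ball x r)" "(x, x) \<in> ball x r \<times> ball x r"
      by (auto intro: open_Times)
    then have "eventually (\<lambda>p. p \<in> ?S r) ?F"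
      unfolding eventually_at_topological by (intro exI[of _ "ball x r \<times> ball x r"]) auto
    then have "eventually (\<lambda>p. ?q p \<le> Sup (?q ` ?S r)) ?F"
      by (rule eventually_mono) (rule SUP_upper)
    then show "local_Lip f x \<le> Sup (?q ` ?S r)"
      unfolding local_Lip_def by (rule Limsup_bounded)
  qed
  show "(INF r\<in>{0<..}. Sup (?q ` ?S r)) \<le> local_Lip f x"
    unfolding local_Lip_def Limsup_def
  proof (rule INF_greatest)
    fix P assume "P \<in> {P. eventually P ?F}"
    then obtain T where T: "open T" "(x, x) \<in> T"
      "\<And>u v. (u, v) \<in> T \<Longrightarrow> u \<noteq> v \<Longrightarrow> P (u, v)"
      by (fastforce simp: eventually_at_topological)
    from open_prod_elim[OF T(1,2)] obtain A B where AB: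
      "open A" "open B" "(x, x) \<in> A \<times> B" "A \<times> B \<subseteq> T" by metis
    then have "open (A \<inter> B)" "x \<in> A \<inter> B" by auto
    then obtain r where r: "r > 0" "ball x r \<subseteq> A \<inter> B"
      by (meson open_contains_ball)
    have "?S r \<subseteq> Collect P"
      using r(2) AB(4) T(3) by blast
    then have "Sup (?q ` ?S r) \<le> Sup (?q ` Collect P)"
      by (intro SUP_subset_mono) auto
    then show "(INF r\<in>{0<..}. Sup (?q ` ?S r)) \<le> Sup (?q ` Collect P)"
      using r(1) by (intro INF_lower2[of r]) auto
  qed
qed

end

theory Submission
  imports Defs
begin

text \<open>
  Choose nested sets \<open>A 0 \<subseteq> A 1 \<subseteq> \<dots>\<close>, each \<open>A n\<close> maximal among the \<open>8\<^sup>-\<^sup>n\<close>-separated sets, and let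
  \<open>h x = (\<Sum>n. 4 ^ n * infdist x (A n))\<close>. At a point of \<open>A m\<close> every term with index at least \<open>m\<close>
  vanishes, and elsewhere these terms are nonnegative, so they cannot cancel; the terms with smaller
  index have Lipschitz constants summing to less than \<open>4 ^ m / 3\<close>. Comparing a point outside \<open>A n\<close>
  with a nearly closest point of \<open>A n\<close>, or a point of \<open>A n\<close> with any point near it, therefore yields
  a slope of at least \<open>4 ^ n / 6\<close>, and the big Lipschitz derivative of \<open>h\<close> is infinite everywhere.
  Multiplying \<open>h\<close> by the distance to the complement of \<open>G\<close> keeps it infinite on \<open>G\<close> and makes it
  finite elsewhere; the local Lipschitz derivative is then infinite on the closure of \<open>G\<close>.
\<close>

section \<open>Criteria for infinite and finite Lipschitz derivatives\<close>

lemma Limsup_eq_infinity: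
  fixes g :: "'b \<Rightarrow> ennreal"
  assumes "\<And>M::real. \<exists>\<^sub>F u in F. ennreal M \<le> g u"
  shows "Limsup F g = \<infinity>"
proof -
  have "ennreal (real n) \<le> Limsup F g" for n
    unfolding Limsup_def
  proof (rule INF_greatest)
    fix P assume "P \<in> {P. eventually P F}"
    then have "\<exists>\<^sub>F u in F. ennreal (real n) \<le> g u \<and> P u"
      using assms[of "real n"] by (simp add: frequently_eventually_conj conj_commute)
    then obtain u where "ennreal (real n) \<le> g u" "P u"
      using frequently_ex by blast
    then show "ennreal (real n) \<le> Sup (g ` Collect P)"
      by (meson SUP_upper2 mem_Collect_eq)
  qed
  then have "\<not> Limsup F g < top"
    using ennreal_Ex_less_of_nat[of "Limsup F g"]
    by (fastforce simp: ennreal_of_nat_eq_real_of_nat not_less[symmetric])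
  then show ?thesis using less_top[of "Limsup F g"] by auto
qed

lemma big_Lip_eq_infinity:
  fixes f :: "'a::metric_space \<Rightarrow> real"
  assumes "\<And>M d. 0 < d \<Longrightarrow> \<exists>u. u \<noteq> x \<and> dist u x < d \<and> M * dist u x \<le> \<bar>f u - f x\<bar>"
  shows "big_Lip f x = \<infinity>"
  unfolding big_Lip_def
proof (rule Limsup_eq_infinity)
  fix M :: real
  show "\<exists>\<^sub>F u in at x. ennreal M \<le> ennreal (\<bar>f u - f x\<bar> / dist u x)"
    unfolding frequently_at
  proof (intro allI impI)
    fix d :: real assume "0 < d"
    then obtain u where u: "u \<noteq> x" "dist u x < d" "M * dist u x \<le> \<bar>f u - f x\<bar>"
      using assms by blast
    then have "ennreal M \<le> ennreal (\<bar>f u - f x\<bar> / dist u x)"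
      by (intro ennreal_leI) (simp add: pos_le_divide_eq)
    with u show "\<exists>u\<in>UNIV. u \<noteq> x \<and> dist u x < d \<and> ennreal M \<le> ennreal (\<bar>f u - f x\<bar> / dist u x)"
      by blast
  qed
qed

text \<open>Every ball around \<open>x\<close> contains a point \<open>y\<close> where the big
  Lipschitz derivative is infinite. For \<open>u\<close> near \<open>y\<close> the pair
  \<open>(u, y)\<close> lies in that ball, so the supremum over pairs from the ball is at least
  \<open>big_Lip f y\<close>.\<close>

lemma local_Lip_eq_infinity_of_closure:
  fixes f :: "'a::metric_space \<Rightarrow> real"
  assumes x: "x \<in> closure (big_Lip_infty f)"
  shows "local_Lip f x = \<infinity>"
proof -
  have "\<infinity> \<le> (SUP (u, v)\<in>{(u, v). u \<in> ball x r \<and> v \<in> ball x r \<and> u \<noteq> v}.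
        ennreal (\<bar>f u - f v\<bar> / dist u v))" (is "_ \<le> ?S") if r: "r > 0" for r
  proof -
    obtain y where y: "y \<in> big_Lip_infty f" "dist y x < r"
      using x r closure_approachable by blast
    have "eventually (\<lambda>u. u \<in> ball x r - {y}) (at y)"
      using y(2) by (intro eventually_at_in_open) (auto simp: dist_commute)
    then have "eventually (\<lambda>u. ennreal (\<bar>f u - f y\<bar> / dist u y) \<le> ?S) (at y)"
    proof eventually_elim
      case (elim u)
      then show ?case
        using y(2) by (intro SUP_upper2[of "(u, y)"]) (auto simp: dist_commute)
    qed
    then have "big_Lip f y \<le> ?S"
      unfolding big_Lip_def by (rule Limsup_bounded)
    with y(1) show ?thesis by (simp add: big_Lip_infty_def)
  qed
  then have "\<infinity> \<le> local_Lip f x"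
    unfolding local_Lip_eq_INF_SUP by (intro INF_greatest) auto
  then show ?thesis by (simp add: top.extremum_unique)
qed

lemma big_Lip_le:
  fixes f :: "'a::metric_space \<Rightarrow> real"
  assumes "\<And>u. \<bar>f u - f x\<bar> \<le> C * dist u x"
  shows "big_Lip f x \<le> ennreal C"
  unfolding big_Lip_def
proof (rule Limsup_bounded)
  show "\<forall>\<^sub>F u in at x. ennreal (\<bar>f u - f x\<bar> / dist u x) \<le> ennreal C"
    unfolding eventually_at_filter
    using assms by (intro always_eventually allI impI ennreal_leI) (simp add: pos_divide_le_eq)
qed

lemma local_Lip_eq_0:
  fixes f :: "'a::metric_space \<Rightarrow> real"
  assumes "open S" "x \<in> S" and f: "\<And>u. u \<in> S \<Longrightarrow> f u = c"
  shows "local_Lip f x = 0"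
proof -
  obtain r where r: "r > 0" "ball x r \<subseteq> S"
    using assms by (meson open_contains_ball)
  have "(SUP (u, v)\<in>{(u, v). u \<in> ball x r \<and> v \<in> ball x r \<and> u \<noteq> v}.
        ennreal (\<bar>f u - f v\<bar> / dist u v)) \<le> 0"
  proof (intro SUP_least, clarify)
    fix u v assume "u \<in> ball x r" "v \<in> ball x r"
    then have "f u = c" "f v = c" using r(2) f by blast+
    then show "ennreal (\<bar>f u - f v\<bar> / dist u v) \<le> 0" by simp
  qed
  then have "local_Lip f x \<le> 0"
    unfolding local_Lip_eq_INF_SUP using r(1) by (intro INF_lower2[of r]) auto
  then show ?thesis by simp
qed

section \<open>Separated sets and nested nets\<close>

definition separated :: "real \<Rightarrow> 'a::metric_space set \<Rightarrow> bool" where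
  "separated r A \<longleftrightarrow> (\<forall>a\<in>A. \<forall>b\<in>A. a \<noteq> b \<longrightarrow> r \<le> dist a b)"

lemma separated_mono: "separated r A \<Longrightarrow> s \<le> r \<Longrightarrow> separated s A"
  unfolding separated_def by force

lemma closed_separated:
  assumes "separated r A" "0 < r"
  shows "closed A"
  using assms unfolding separated_def
  by (intro discrete_imp_closed[of r]) force+

text \<open>Zorn's lemma gives a maximal separated superset. It is an \<open>r\<close>-net, since a
  point at distance at least \<open>r\<close> from all of it could be added.\<close>

lemma separated_extend:
  fixes A :: "'a::metric_space set"
  assumes A: "separated r A" and r: "0 < r"
  obtains B where "A \<subseteq> B" "separated r B" "\<And>x. \<exists>b\<in>B. dist x b < r"
proof -
  let ?F = "{B. A \<subseteq> B \<and> separated r B}"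
  have "\<exists>B\<in>?F. \<forall>X\<in>?F. B \<subseteq> X \<longrightarrow> X = B"
  proof (rule subset_Zorn_nonempty)
    show "?F \<noteq> {}" using A by blast
    fix \<C> assume C: "\<C> \<noteq> {}" "subset.chain ?F \<C>"
    have "separated r (\<Union>\<C>)"
      unfolding separated_def
    proof (intro ballI impI)
      fix a b assume "a \<in> \<Union>\<C>" "b \<in> \<Union>\<C>" and ne: "a \<noteq> b"
      then obtain S where "S \<in> \<C>" "a \<in> S" "b \<in> S"
        using C(2) unfolding subset_chain_def by blast
      moreover from this have "separated r S"
        using C(2) unfolding subset_chain_def by blast
      ultimately show "r \<le> dist a b"
        using ne unfolding separated_def by blast
    qed
    then show "\<Union>\<C> \<in> ?F"
      using C unfolding subset_chain_def by blast
  qed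
  then obtain B where "B \<in> ?F" and max: "\<forall>X\<in>?F. B \<subseteq> X \<longrightarrow> X = B"
    by (rule bexE)
  then have B: "A \<subseteq> B" "separated r B" by auto
  have "\<exists>b\<in>B. dist x b < r" for x
  proof (rule ccontr)
    assume neg: "\<not> (\<exists>b\<in>B. dist x b < r)"
    then have "separated r (insert x B)"
      using B(2) unfolding separated_def by (auto simp: not_less dist_commute)
    then have "insert x B = B"
      using B(1) by (intro max[rule_format]) auto
    then have "x \<in> B" by blast
    with neg r show False by auto
  qed
  with B that show ?thesis by blast
qed

text \<open>Separation at one scale implies separation at every smaller scale, so each set can be
  extended to a net at the next scale. The recursion starts by extending the empty set.\<close>

lemma exists_nested_separated:
  obtains A :: "nat \<Rightarrow> 'a::metric_space set" where "mono A"
    "\<And>n. separated ((1/8) ^ n) (A n)" "\<And>n x. \<exists>a\<in>A n. dist x a < (1/8) ^ n"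
proof -
  let ?P = "\<lambda>n A :: 'a set. separated ((1/8) ^ n) A \<and> (\<forall>x. \<exists>a\<in>A. dist x a < (1/8) ^ n)"
  have "\<exists>A. \<forall>n. ?P n (A n) \<and> A n \<subseteq> A (Suc n)"
  proof (rule dependent_nat_choice)
    have "separated ((1/8) ^ 0) ({} :: 'a set)" by (simp add: separated_def)
    then show "\<exists>A. ?P 0 A"
      by (rule separated_extend) auto
  next
    fix A :: "'a set" and n assume "?P n A"
    then have "separated ((1/8) ^ Suc n) A"
      by (auto intro: separated_mono)
    then show "\<exists>B. ?P (Suc n) B \<and> A \<subseteq> B"
      by (rule separated_extend[of "(1/8) ^ Suc n" A]) auto
  qed
  then obtain A where A: "\<And>n. ?P n (A n)" "\<And>n. A n \<subseteq> A (Suc n)" by blast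
  then have "mono A" by (simp add: mono_iff_le_Suc)
  with A(1) that show ?thesis by blast
qed

section \<open>A bounded continuous function that is steep everywhere\<close>

lemma exists_big_Lip_infinite:
  obtains h :: "'a::{metric_space, perfect_space} \<Rightarrow> real" where
    "continuous_on UNIV h" "\<And>x. 0 \<le> h x" "\<And>x. h x \<le> 2"
    "\<And>x M d. 0 < d \<Longrightarrow> \<exists>u. u \<noteq> x \<and> dist u x < d \<and> M * dist u x \<le> \<bar>h u - h x\<bar>"
proof -
  obtain A :: "nat \<Rightarrow> 'a set" where mono: "mono A"
    and sep: "\<And>n. separated ((1/8) ^ n) (A n)" and near: "\<And>n x. \<exists>a\<in>A n. dist x a < (1/8) ^ n"
    using exists_nested_separated by blast
  have ne: "A n \<noteq> {}" for n using near by blast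
  have cl: "closed (A n)" for n using sep by (rule closed_separated) simp
  have inf_le: "infdist x (A n) \<le> (1/8) ^ n" for x n
    using near[where x = x and n = n] by (meson infdist_le2 less_imp_le)
  \<comment> \<open>The weights \<open>4 ^ n\<close> make the slopes unbounded, while
    \<open>4 ^ n * (1/8) ^ n = (1/2) ^ n\<close> keeps the series uniformly convergent.\<close>
  define t where "t n x = 4 ^ n * infdist x (A n)" for n x
  define h where "h x = (\<Sum>n. t n x)" for x
  have t_nonneg: "0 \<le> t n x" for n x by (simp add: t_def infdist_nonneg)
  have t_le: "t n x \<le> (1/2) ^ n" for n x
  proof -
    have "t n x \<le> 4 ^ n * (1/8) ^ n"
      unfolding t_def by (intro mult_left_mono inf_le) simp
    then show ?thesis by (simp flip: power_mult_distrib)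
  qed
  have summ: "summable (\<lambda>n. t n x)" for x
    using t_nonneg t_le by (intro summable_comparison_test[OF _ summable_geometric[of "1/2::real"]]) auto
  have "continuous_on UNIV h"
  proof (rule uniform_limit_theorem[where F = sequentially])
    show "\<forall>\<^sub>F n in sequentially. continuous_on UNIV (\<lambda>x. \<Sum>i<n. t i x)"
      unfolding t_def by (intro always_eventually allI continuous_intros)
    show "uniform_limit UNIV (\<lambda>n x. \<Sum>i<n. t i x) h sequentially"
      unfolding h_def using t_nonneg t_le
      by (intro Weierstrass_m_test[of _ _ "\<lambda>n. (1/2) ^ n"]) (auto simp: summable_geometric)
  qed simp
  moreover have "0 \<le> h x" for x
    unfolding h_def using t_nonneg summ by (intro suminf_nonneg)
  moreover have "h x \<le> 2" for x
  proof -
    have "h x \<le> (\<Sum>n. (1/2::real) ^ n)"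
      unfolding h_def by (intro suminf_le t_le summ) (simp add: summable_geometric)
    then show ?thesis by (simp add: suminf_geometric)
  qed
  moreover have "\<exists>u. u \<noteq> x \<and> dist u x < d \<and> M * dist u x \<le> \<bar>h u - h x\<bar>" if d: "0 < d" for x M d
  proof -
    \<comment> \<open>Term \<open>n\<close> contributes slope at least \<open>1/2\<close> times
      \<open>4 ^ n\<close>, the terms below \<open>m\<close> cost at most \<open>1/3\<close> of it,
      and \<open>1/2 - 1/3 = 1/6\<close>. The factor 2 in \<open>far\<close> allows for a distance
      to \<open>A n\<close> that is not attained.\<close>
    have growth: "4 ^ n / 6 * dist y a \<le> h y - h a"
      if a: "a \<in> A m" and mn: "m \<le> n" and far: "dist y a \<le> 2 * infdist y (A n)" for y a m n
    proof -
      have zero: "t k a = 0" if "m \<le> k" for k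
        using a monoD[OF mono that] by (auto simp: t_def)
      \<comment> \<open>As \<open>infdist\<close> is 1-Lipschitz, \<open>t k\<close> is
        \<open>4 ^ k\<close>-Lipschitz; the constants form a geometric sum.\<close>
      have "- (4 ^ m / 3 * dist y a) \<le> (\<Sum>k<m. t k y - t k a)"
      proof -
        have "(\<Sum>k<m. (4::real) ^ k) \<le> 4 ^ m / 3"
          by (simp add: sum_gp_strict field_simps)
        then have "(\<Sum>k<m. 4 ^ k * dist y a) \<le> 4 ^ m / 3 * dist y a"
          unfolding sum_distrib_right[symmetric] by (rule mult_right_mono) simp
        moreover have "(\<Sum>k<m. - (4 ^ k * dist y a)) \<le> (\<Sum>k<m. t k y - t k a)"
        proof (rule sum_mono)
          fix k
          have "4 ^ k * (- dist y a) \<le> 4 ^ k * (infdist y (A k) - infdist a (A k))"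
            using infdist_triangle_abs[of y "A k" a] by (intro mult_left_mono) auto
          then show "- (4 ^ k * dist y a) \<le> t k y - t k a"
            by (simp add: t_def algebra_simps)
        qed
        ultimately show ?thesis by (simp add: sum_negf)
      qed
      moreover have "t n y \<le> (\<Sum>k=m..n. t k y - t k a)"
      proof -
        have "t n y - t n a \<le> (\<Sum>k=m..n. t k y - t k a)"
          using mn zero t_nonneg by (intro member_le_sum) auto
        then show ?thesis using zero[OF mn] by simp
      qed
      moreover have "(\<Sum>k\<le>n. t k y - t k a) = (\<Sum>k<m. t k y - t k a) + (\<Sum>k=m..n. t k y - t k a)"
        using mn by (subst sum.union_disjoint[symmetric]) (auto intro!: sum.cong)
      moreover have "(\<Sum>k\<le>n. t k y - t k a) \<le> (\<Sum>k. t k y - t k a)"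
        using mn zero t_nonneg by (intro sum_le_suminf summable_diff summ) auto
      moreover have "(\<Sum>k. t k y - t k a) = h y - h a"
        unfolding h_def using summ by (simp add: suminf_diff)
      moreover have "4 ^ n / 2 * dist y a \<le> t n y"
        using far by (simp add: t_def)
      moreover have "(4::real) ^ m / 3 * dist y a \<le> 4 ^ n / 3 * dist y a"
        using mn by (intro mult_right_mono divide_right_mono power_increasing) auto
      ultimately show ?thesis by linarith
    qed
    have "\<forall>\<^sub>F n in sequentially. 6 * M \<le> 4 ^ n"
    proof -
      obtain N where "6 * M < 4 ^ N" using real_arch_pow[of 4 "6 * M"] by auto
      then have "6 * M \<le> 4 ^ n" if "N \<le> n" for n
        using power_increasing[OF that, of "4::real"] by linarith
      then show ?thesis unfolding eventually_sequentially by blast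
    qed
    \<comment> \<open>Half of \<open>d\<close> suffices because a nearly closest point of
      \<open>A n\<close> lies within twice \<open>(1/8) ^ n\<close>.\<close>
    moreover have "\<forall>\<^sub>F n in sequentially. (1/8::real) ^ n < d / 2"
      using d by (intro order_tendstoD(2)[OF LIMSEQ_realpow_zero]) auto
    ultimately have ev: "\<forall>\<^sub>F n in sequentially. 6 * M \<le> 4 ^ n \<and> (1/8) ^ n < d / 2"
      by (rule eventually_conj)
    show ?thesis
    proof (cases "\<exists>m. x \<in> A m")
      case True
      then obtain m where m: "x \<in> A m" by blast
      from ev obtain n where n: "m \<le> n" "6 * M \<le> 4 ^ n"
        unfolding eventually_sequentially by (meson nle_le)
      have xn: "x \<in> A n" using m monoD[OF mono n(1)] by blast
      \<comment> \<open>Such a \<open>u\<close> exists because \<open>x\<close> is not isolated.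
        Within half the separation of \<open>A n\<close>, the point \<open>x\<close> remains a
        closest point of \<open>A n\<close> to \<open>u\<close>.\<close>
      obtain u where u: "u \<noteq> x" "dist u x < min d ((1/8) ^ n / 2)"
        using d islimpt_UNIV[of x] unfolding islimpt_approachable
        by (force dest: spec[of _ "min d ((1/8) ^ n / 2)"])
      have "dist u x \<le> dist u b" if "b \<in> A n" for b
      proof (cases "b = x")
        case False
        then have "(1/8) ^ n \<le> dist x b"
          using sep[of n] xn that unfolding separated_def by auto
        then show ?thesis
          using u(2) dist_triangle[of x b u] by (simp add: dist_commute)
      qed simp
      then have "dist u x \<le> infdist u (A n)"
        unfolding infdist_notempty[OF ne] using ne by (intro cINF_greatest)
      then have "4 ^ n / 6 * dist u x \<le> h u - h x"
        using infdist_nonneg[of u "A n"] by (intro growth[OF m n(1)]) linarith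
      moreover have "M * dist u x \<le> 4 ^ n / 6 * dist u x"
        using n(2) by (intro mult_right_mono) auto
      ultimately have "M * dist u x \<le> \<bar>h u - h x\<bar>" by linarith
      with u show ?thesis by auto
    next
      case False
      from ev obtain n where n: "6 * M \<le> 4 ^ n" "(1/8) ^ n < d / 2"
        unfolding eventually_sequentially by blast
      \<comment> \<open>Positivity makes twice the infimum strictly larger than the infimum, so some
        point of \<open>A n\<close> is closer than that.\<close>
      have pos: "0 < infdist x (A n)"
        using False cl ne infdist_nonneg[of x "A n"] in_closed_iff_infdist_zero[of "A n" x] by force
      then have "\<exists>u\<in>A n. dist x u < 2 * infdist x (A n)"
        using cINF_less_iff[of "A n" "dist x" "2 * infdist x (A n)"] ne[of n]
        by (simp add: infdist_notempty)
      then obtain u where u: "u \<in> A n" "dist x u < 2 * infdist x (A n)" by blast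
      \<comment> \<open>The roles are exchanged here: \<open>x\<close> is the point off the net and
        \<open>u\<close> the net point, with \<open>m = n\<close>.\<close>
      have "4 ^ n / 6 * dist x u \<le> h x - h u"
        using u by (intro growth[of u n n]) auto
      moreover have "M * dist x u \<le> 4 ^ n / 6 * dist x u"
        using n(1) by (intro mult_right_mono) auto
      ultimately have "M * dist u x \<le> \<bar>h u - h x\<bar>"
        unfolding dist_commute[of u] by linarith
      moreover have "dist x u < d"
        using u(2) inf_le[of x n] n(2) by linarith
      moreover have "u \<noteq> x" using u(1) False by blast
      ultimately show ?thesis by (intro exI[of _ u]) (auto simp: dist_commute)
    qed
  qed
  ultimately show ?thesis using that by blast
qed

section \<open>Localising the steep function to an open set\<close>

theorem theorem7p3:
  fixes G :: "'a::{metric_space, perfect_space} set"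
  assumes "open G"
  shows "\<exists>f :: 'a \<Rightarrow> real. continuous_on UNIV f \<and>
           big_Lip_infty f = G \<and> local_Lip_infty f = closure G"
proof -
  obtain h :: "'a \<Rightarrow> real" where cont: "continuous_on UNIV h"
    and h: "\<And>x. 0 \<le> h x" "\<And>x. h x \<le> 2"
    and steep: "\<And>x M d. 0 < d \<Longrightarrow> \<exists>u. u \<noteq> x \<and> dist u x < d \<and> M * dist u x \<le> \<bar>h u - h x\<bar>"
    using exists_big_Lip_infinite by blast
  \<comment> \<open>The case distinction is needed because \<open>infdist u {} = 0\<close>.\<close>
  define \<phi> where "\<phi> u = (if G = UNIV then 1 else infdist u (- G))" for u
  define f where "f u = \<phi> u * h u" for u
  have lip: "\<bar>\<phi> u - \<phi> v\<bar> \<le> dist u v" for u v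
    by (simp add: \<phi>_def infdist_triangle_abs)
  have pos: "0 < \<phi> u" if "u \<in> G" for u
  proof (cases "G = UNIV")
    case False
    have "closed (- G)" using assms by (rule closed_Compl)
    then show ?thesis
      using that False in_closed_iff_infdist_zero[of "- G" u] infdist_nonneg[of u "- G"]
      by (force simp: \<phi>_def)
  qed (simp add: \<phi>_def)
  have zero: "\<phi> u = 0" if "u \<notin> G" for u
    using that by (auto simp: \<phi>_def)
  have "continuous_on UNIV \<phi>"
    unfolding \<phi>_def by (cases "G = UNIV") (auto intro!: continuous_intros)
  then have "continuous_on UNIV f"
    unfolding f_def using cont by (intro continuous_intros)
  moreover have big: "big_Lip_infty f = G"
  proof -
    have "big_Lip f x = \<infinity>" if x: "x \<in> G" for x
    proof (rule big_Lip_eq_infinity)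
      fix M d :: real assume "0 < d"
      \<comment> \<open>Multiplying by \<open>\<phi> x\<close> turns this slope into
        \<open>M + 2\<close>. The surplus 2 pays for the variation of \<open>\<phi>\<close>, which
        is 1-Lipschitz and gets multiplied by \<open>h u \<le> 2\<close>.\<close>
      then obtain u where u: "u \<noteq> x" "dist u x < d" "(M + 2) / \<phi> x * dist u x \<le> \<bar>h u - h x\<bar>"
        using steep by blast
      have "(M + 2) * dist u x \<le> \<bar>\<phi> x * (h u - h x)\<bar>"
        using u(3) pos[OF x] by (simp add: abs_mult pos_divide_le_eq mult.commute)
      moreover have "\<bar>h u * (\<phi> u - \<phi> x)\<bar> \<le> 2 * dist u x"
        unfolding abs_mult using h lip[of u x] by (intro mult_mono) auto
      moreover have "f u - f x = \<phi> x * (h u - h x) + h u * (\<phi> u - \<phi> x)"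
        by (simp add: f_def algebra_simps)
      ultimately have "M * dist u x \<le> \<bar>f u - f x\<bar>"
        by (simp add: algebra_simps)
      with u show "\<exists>u. u \<noteq> x \<and> dist u x < d \<and> M * dist u x \<le> \<bar>f u - f x\<bar>" by blast
    qed
    moreover have "big_Lip f x \<noteq> \<infinity>" if x: "x \<notin> G" for x
    proof -
      \<comment> \<open>Since \<open>\<phi> x = 0\<close>, the increment is just
        \<open>\<phi> u * h u\<close>, so the steepness of \<open>h\<close> has no effect at
        \<open>x\<close>.\<close>
      have "\<bar>f u - f x\<bar> \<le> 2 * dist u x" for u
      proof -
        have "\<bar>h u\<bar> * \<bar>\<phi> u - \<phi> x\<bar> \<le> 2 * dist u x"
          using h lip[of u x] by (intro mult_mono) auto
        then show ?thesis using zero[OF x] by (simp add: f_def abs_mult mult.commute)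
      qed
      then have "big_Lip f x \<le> ennreal 2" by (rule big_Lip_le)
      then show ?thesis by (auto simp: top_unique)
    qed
    ultimately show ?thesis unfolding big_Lip_infty_def by blast
  qed
  moreover have "local_Lip_infty f = closure G"
  proof -
    have "local_Lip f x = \<infinity>" if "x \<in> closure G" for x
      using that big by (intro local_Lip_eq_infinity_of_closure) simp
    \<comment> \<open>Here \<open>f\<close> vanishes on a whole neighbourhood of \<open>x\<close>,
      the open complement of the closure.\<close>
    moreover have "local_Lip f x = 0" if "x \<notin> closure G" for x
    proof (rule local_Lip_eq_0[of "- closure G"])
      fix u assume "u \<in> - closure G"
      then have "u \<notin> G" using closure_subset by blast
      then show "f u = 0" by (simp add: f_def zero)
    qed (use that in auto)
    ultimately show ?thesis unfolding local_Lip_infty_def by force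
  qed
  ultimately show ?thesis by blast
qed

end
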